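(* Let $r,\alpha,\beta,\gamma$ be positive integers and $p$ a prime with $p>\alpha+\beta+\gamma$. If $\alpha+\beta+\gamma$ is odd, then $$Z_{p^r}(\alpha,\beta,\gamma)\equiv p^{r-1}Z_p(\alpha,\beta,\gamma)\pmod{p^r}.$$ If $\alpha+\beta+\gamma$ is even, then $$Z_{p^r}(\alpha,\beta,\gamma)\equiv p^{2r-2}Z_p(\alpha,\beta,\gamma)\pmod{p^{2r}}.$$
   Context: Let $\mathcal{P}_p$ be the set of positive integers not divisible by the prime $p$. For positive integers $r,d,s_1,\dots,s_d$ define $$Z_{p^r}(s_1,\dots,s_d)=\sum_{\substack{k_1+\cdots+k_d=p^r\\ k_1,\dots,k_d\in\mathcal{P}_p}}\frac{1}{k_1^{s_1}\cdots k_d^{s_d}}.$$ Congruences are in the ring of $p$-integral rationals. *)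

theory Defs
  imports Complex_Main "HOL-Computational_Algebra.Primes"
begin

definition pos_nondiv :: "nat \<Rightarrow> nat set" where
  "pos_nondiv p = {k. 0 < k \<and> \<not> p dvd k}"

text \<open>The multiple sum over compositions of \<open>p ^ r\<close>; the depth \<open>d\<close> is the length of the
  exponent list \<open>s\<close>, and tuples are zero-indexed lists.\<close>

definition Zsum :: "nat \<Rightarrow> nat \<Rightarrow> nat list \<Rightarrow> rat" where
  "Zsum p r s =
     (\<Sum>k | length k = length s \<and> set k \<subseteq> pos_nondiv p \<and> sum_list k = p ^ r.
        1 / (\<Prod>i<length s. of_nat (k ! i) ^ (s ! i)))"

text \<open>\<open>quotient_of\<close> returns the fraction in lowest terms.\<close>

definition p_integral :: "nat \<Rightarrow> rat set" where
  "p_integral p = {x. \<not> int p dvd snd (quotient_of x)}"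

definition p_integral_cong :: "nat \<Rightarrow> nat \<Rightarrow> rat \<Rightarrow> rat \<Rightarrow> bool" where
  "p_integral_cong p n x y \<longleftrightarrow>
     x \<in> p_integral p \<and> y \<in> p_integral p \<and>
     (\<exists>c \<in> p_integral p. x - y = of_nat (p ^ n) * c)"

end

theory Submission
  imports Defs "HOL-Number_Theory.Number_Theory"
begin

text \<open>
  Modulo \<open>p ^ (2 * r)\<close> every unit satisfies \<open>k powi (- \<alpha>) = k ^ (\<phi> - \<alpha>)\<close> with \<open>\<phi> = totient (p ^ (2 * r))\<close>,
  so the sum may be replaced by an integral power sum with exponents \<open>A, B, C\<close> of the same total
  parity \<open>w\<close>. Put \<open>M = p ^ (r - 1)\<close> and write each entry as \<open>a + p * b\<close> with \<open>0 < a < p\<close>. The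
  residues add up to \<open>p\<close> or to \<open>2 * p\<close>, and \<open>a \<mapsto> p - a\<close> exchanges the two cases. Newton's expansion
  \<open>(a + p * x) ^ A = (\<Sum>i. p ^ i * u i * (x gchoose i))\<close> with integers \<open>u i\<close> holds for all integers \<open>x\<close>; used
  at \<open>x = b\<close> and at \<open>x = - 1 - b\<close> and summed over \<open>b\<close> by Vandermonde convolution, it
  expresses the power sum as a combination, with coefficients independent of \<open>r\<close>, of the terms
  \<open>p ^ m * (g M + (- 1) ^ w * g (- M))\<close>, where \<open>g x = (x + 1) gchoose (m + 2)\<close>. The bracket is an
  odd or even polynomial in \<open>M\<close> without constant term whose denominator divides \<open>fact (m + 2)\<close>. For \<open>p \<ge> 5\<close>
  this denominator is too small to spoil the factor \<open>p ^ m\<close>, so only \<open>m = 0\<close> survives, where the bracket is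
  \<open>M\<close> or \<open>M\<^sup>2\<close>.
\<close>

subsection \<open>Binomial convolutions and Newton expansions\<close>

text \<open>Legendre's recursion: among the factors up to \<open>p * q + t\<close> only
  \<open>p, 2 * p, ..., p * q\<close> are multiples of \<open>p\<close>, and dividing each of them
  by \<open>p\<close> leaves \<open>fact q\<close>.\<close>

lemma multiplicity_fact_mult_add:
  fixes p :: nat
  assumes p: "prime p" and "t < p"
  shows "multiplicity p (fact (p * q + t) :: nat) = q + multiplicity p (fact q :: nat)"
proof -
  have p0: "p > 0" and nu: "\<not> is_unit p" using p prime_gt_1_nat[OF p] by auto
  have step: "multiplicity p (fact (Suc n) :: nat) = multiplicity p (Suc n) + multiplicity p (fact n :: nat)" for n
    using p by (simp add: prime_elem_multiplicity_mult_distrib del: mult_Suc)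
  have rem: "multiplicity p (fact (p * q + t) :: nat) = multiplicity p (fact (p * q) :: nat)" if "t < p" for q t
    using that
  proof (induction t)
    case (Suc t)
    have "\<not> p dvd (p * q + Suc t)"
      using Suc.prems by (metis dvd_add_right_iff dvd_triv_left nat_dvd_not_less zero_less_Suc)
    then show ?case using step[of "p * q + t"] Suc by (simp add: not_dvd_imp_multiplicity_0)
  qed simp
  have "multiplicity p (fact (p * q) :: nat) = q + multiplicity p (fact q :: nat)"
  proof (induction q)
    case (Suc q)
    have e: "p * Suc q = Suc (p * q + (p - 1))" using p0 by simp
    have "multiplicity p (fact (p * Suc q) :: nat) = multiplicity p (p * Suc q) + multiplicity p (fact (p * q + (p - 1)) :: nat)"
      unfolding e by (rule step)
    also have "multiplicity p (p * Suc q) = Suc (multiplicity p (Suc q))"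
      using nu p0 by (intro multiplicity_times_same) auto
    finally show ?case using rem[of "p - 1" q] Suc step[of q] p0 by simp
  qed simp
  with rem assms show ?thesis by simp
qed

text \<open>By Legendre's formula the left side is \<open>n\<close> minus its digit sum in base
  \<open>p\<close>. Here the bound comes by induction from the recursion, since
  \<open>(p - 1) * q + q = p * q \<le> n\<close> for \<open>q = n div p\<close>.\<close>

lemma multiplicity_fact_less:
  fixes p n :: nat
  assumes p: "prime p" and "0 < n"
  shows "(p - 1) * multiplicity p (fact n :: nat) < n"
  using \<open>0 < n\<close>
proof (induction n rule: less_induct)
  case (less n)
  have p1: "p > 1" using p by (rule prime_gt_1_nat)
  define q t where "q = n div p" and "t = n mod p"
  have n: "n = p * q + t" "t < p" using p1 by (auto simp: q_def t_def)
  have v: "multiplicity p (fact n :: nat) = q + multiplicity p (fact q :: nat)"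
    using multiplicity_fact_mult_add[OF p n(2)] n(1) by simp
  show ?case
  proof (cases "q = 0")
    case True
    then show ?thesis using v less.prems by simp
  next
    case False
    then have "q < n" using p1 less.prems by (simp add: q_def)
    with False less.IH have "(p - 1) * multiplicity p (fact q :: nat) < q" by blast
    moreover have "(p - 1) * q + q = p * q"
      using p1 by (cases p) auto
    ultimately show ?thesis unfolding v using n(1) by (simp add: algebra_simps)
  qed
qed

section \<open>Convolutions of binomial coefficients over two and three indices\<close>

text \<open>Counts the subsets of \<open>{0..n}\<close> with \<open>i + j + 1\<close> elements by
  the member \<open>b\<close> that has exactly \<open>i\<close> smaller members.\<close>

lemma sum_choose_conv:
  "(\<Sum>b\<le>n. (b choose i) * ((n - b) choose j)) = Suc n choose Suc (i + j)"
proof (induction n arbitrary: j)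
  case 0
  then show ?case by (cases i; cases j) auto
next
  case (Suc n)
  show ?case
  proof (cases j)
    case 0
    then show ?thesis using sum_choose_upper[of i "Suc n"] by simp
  next
    case (Suc k)
    have "(\<Sum>b\<le>Suc n. (b choose i) * ((Suc n - b) choose j)) =
      (\<Sum>b\<le>n. (b choose i) * (Suc (n - b) choose Suc k))"
      using Suc by (simp add: Suc_diff_le)
    also have "\<dots> = (\<Sum>b\<le>n. (b choose i) * ((n - b) choose k)) + (\<Sum>b\<le>n. (b choose i) * ((n - b) choose Suc k))"
      by (simp add: sum.distrib algebra_simps)
    finally show ?thesis using Suc.IH Suc by simp
  qed
qed

text \<open>Both sides are the coefficient of X^n in (1 - X)^(-i-1) (1 - X)^(-j-1). Pascal's rule
  lowers either \<open>n\<close> or \<open>j\<close>, hence the induction on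
  \<open>n + j\<close>.\<close>

lemma sum_choose_add_conv:
  "(\<Sum>b\<le>n. ((b + i) choose i) * ((n - b + j) choose j)) = (n + Suc (i + j)) choose Suc (i + j)"
proof (induction "n + j" arbitrary: n j rule: less_induct)
  case less
  show ?case
  proof (cases n)
    case (Suc l)
    show ?thesis
    proof (cases j)
      case 0
      have "(\<Sum>b\<le>n. ((b + i) choose i)) = (n + Suc i) choose Suc i"
        using sum_choose_lower[of i n] binomial_symmetric
        by (metis (no_types, lifting) choose_rising_sum(1) add.commute add_Suc_right plus_1_eq_Suc sum.cong)
      then show ?thesis using 0 by simp
    next
      case (Suc k)
      have "(\<Sum>b\<le>n. ((b + i) choose i) * ((n - b + j) choose j)) =
         (\<Sum>b\<le>l. ((b + i) choose i) * (Suc (l - b + j) choose Suc k)) + ((n + i) choose i)"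
        using Suc \<open>n = Suc l\<close> by (simp add: Suc_diff_le)
      also have "\<dots> = (\<Sum>b\<le>l. ((b + i) choose i) * ((l - b + j) choose j)) +
           ((\<Sum>b\<le>l. ((b + i) choose i) * ((n - b + k) choose k)) + ((n + i) choose i))"
        using Suc \<open>n = Suc l\<close> by (simp add: sum.distrib algebra_simps Suc_diff_le)
      also have "(\<Sum>b\<le>l. ((b + i) choose i) * ((n - b + k) choose k)) + ((n + i) choose i)
         = (\<Sum>b\<le>n. ((b + i) choose i) * ((n - b + k) choose k))"
        using \<open>n = Suc l\<close> by simp
      finally show ?thesis
        using less[of l j] less[of n k] Suc \<open>n = Suc l\<close> by simp
    qed
  qed simp
qed

definition triples :: "nat \<Rightarrow> (nat \<times> nat \<times> nat) set" where
  "triples n = {(x, y, z). x + y + z = n}"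

lemma finite_triples [simp]: "finite (triples n)"
  by (rule finite_subset[of _ "{..n} \<times> {..n} \<times> {..n}"]) (auto simp: triples_def)

lemma sum_triples:
  fixes f g h :: "nat \<Rightarrow> 'a :: comm_semiring_1"
  shows "(\<Sum>(x, y, z)\<in>triples n. f x * g y * h z) =
    (\<Sum>c\<le>n. (\<Sum>x\<le>c. f x * g (c - x)) * h (n - c))"
proof -
  have "(\<Sum>c\<le>n. (\<Sum>x\<le>c. f x * g (c - x)) * h (n - c)) =
     (\<Sum>(c, x)\<in>Sigma {..n} (\<lambda>c. {..c}). f x * g (c - x) * h (n - c))"
    by (simp add: sum.Sigma sum_distrib_right)
  also have "\<dots> = (\<Sum>(x, y, z)\<in>triples n. f x * g y * h z)"
    by (rule sum.reindex_bij_witness[of _ "\<lambda>(x, y, z). (x + y, x)" "\<lambda>(c, x). (x, c - x, n - c)"])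
       (auto simp: triples_def)
  finally show ?thesis ..
qed

lemma sum_triples_choose:
  "(\<Sum>(x, y, z)\<in>triples n. (x choose i) * (y choose j) * (z choose k)) =
     (n + 2) choose (i + j + k + 2)"
proof -
  have "(\<Sum>(x, y, z)\<in>triples n. (x choose i) * (y choose j) * (z choose k)) =
    (\<Sum>c\<le>n. (Suc c choose Suc (i + j)) * ((Suc n - Suc c) choose k))"
    by (simp add: sum_triples sum_choose_conv del: binomial_Suc_Suc)
  \<comment> \<open>The index moves up by one; the new term at \<open>c = 0\<close> vanishes because
    \<open>0 choose Suc (i + j)\<close> is 0.\<close>
  also have "\<dots> = (\<Sum>c\<le>Suc n. (c choose Suc (i + j)) * ((Suc n - c) choose k))"
    by (subst sum.atMost_Suc_shift) simp
  finally show ?thesis by (simp add: sum_choose_conv del: binomial_Suc_Suc)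
qed

lemma sum_triples_choose_add:
  "(\<Sum>(x, y, z)\<in>triples n. ((x + i) choose i) * ((y + j) choose j) * ((z + k) choose k)) =
     (n + (i + j + k + 2)) choose (i + j + k + 2)"
proof -
  have "(\<Sum>(x, y, z)\<in>triples n. ((x + i) choose i) * ((y + j) choose j) * ((z + k) choose k)) =
    (\<Sum>c\<le>n. ((c + Suc (i + j)) choose Suc (i + j)) * ((n - c + k) choose k))"
    by (simp only: sum_triples sum_choose_add_conv)
  then show ?thesis by (simp only: sum_choose_add_conv) simp
qed

text \<open>\<open>q ^ i * newton_coeff q a n i\<close> is the \<open>i\<close>-th forward difference of \<open>(a + q * x) ^ n\<close> at \<open>x = 0\<close>.\<close>

primrec newton_coeff :: "int \<Rightarrow> int \<Rightarrow> nat \<Rightarrow> nat \<Rightarrow> int" where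
  "newton_coeff q a 0 i = (if i = 0 then 1 else 0)"
| "newton_coeff q a (Suc n) i = (a + q * int i) * newton_coeff q a n i + int i * newton_coeff q a n (i - 1)"

lemma newton_coeff_eq_0: "n < i \<Longrightarrow> newton_coeff q a n i = 0"
  by (induction n arbitrary: i) auto

lemma newton_coeff_0 [simp]: "newton_coeff q a n 0 = a ^ n"
  by (induction n) auto

text \<open>The hypotheses say that \<open>B i\<close> behaves like \<open>x gchoose i\<close>.\<close>

lemma newton_expansion:
  fixes a q x :: int and B :: "nat \<Rightarrow> int"
  assumes "B 0 = 1" and B: "\<And>i. x * B i = int i * B i + int (Suc i) * B (Suc i)"
  shows "(a + q * x) ^ n = (\<Sum>i\<le>n. q ^ i * newton_coeff q a n i * B i)"
proof (induction n)
  case 0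
  then show ?case using assms by simp
next
  case (Suc n)
  let ?u = "newton_coeff q a"
  have "(a + q * x) ^ Suc n = (\<Sum>i\<le>n. q ^ i * ?u n i * (a * B i + q * (x * B i)))"
    by (simp add: Suc sum_distrib_left algebra_simps)
  also have "\<dots> = (\<Sum>i\<le>n. q ^ i * ((a + q * int i) * ?u n i) * B i) +
      (\<Sum>i\<le>n. q ^ Suc i * (int (Suc i) * ?u n i) * B (Suc i))"
    unfolding B by (simp add: sum.distrib[symmetric] algebra_simps)
  also have "(\<Sum>i\<le>n. q ^ i * ((a + q * int i) * ?u n i) * B i) =
      (\<Sum>i\<le>Suc n. q ^ i * ((a + q * int i) * ?u n i) * B i)"
    by (simp add: newton_coeff_eq_0)
  \<comment> \<open>After the shift the term at \<open>i = 0\<close> vanishes through its factor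
    \<open>int i\<close>, so the truncated \<open>i - 1\<close> does no harm there.\<close>
  also have "(\<Sum>i\<le>n. q ^ Suc i * (int (Suc i) * ?u n i) * B (Suc i)) =
      (\<Sum>i\<le>Suc n. q ^ i * (int i * ?u n (i - 1)) * B i)"
    by (simp add: sum.atMost_Suc_shift del: sum.atMost_Suc)
  finally show ?case by (simp only: sum.distrib[symmetric] newton_coeff.simps) (simp add: algebra_simps)
qed

lemma newton_expansion_choose:
  "(a + q * int b) ^ n = (\<Sum>i\<le>n. q ^ i * newton_coeff q a n i * int (b choose i))"
proof (rule newton_expansion)
  fix i
  have "b * (b choose i) = i * (b choose i) + Suc i * (b choose Suc i)"
  proof (cases "i \<le> b")
    case True
    have "Suc i * (b choose Suc i) = (b - i) * (b choose i)"
      using binomial_absorption binomial_absorb_comp by simp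
    then show ?thesis using True by (metis add_mult_distrib le_add_diff_inverse)
  qed (simp add: binomial_eq_0)
  then show "int b * int (b choose i) = int i * int (b choose i) + int (Suc i) * int (b choose Suc i)"
    by (metis of_nat_add of_nat_mult)
qed simp

text \<open>The factor \<open>(- 1) ^ i * int ((b + i) choose i)\<close> is
  \<open>(- 1 - b) gchoose i\<close>, so this is the same Newton series at a negative point.\<close>

lemma newton_expansion_choose_neg:
  "(a + q * (- 1 - int b)) ^ n = (\<Sum>i\<le>n. q ^ i * newton_coeff q a n i * ((- 1) ^ i * int ((b + i) choose i)))"
proof (rule newton_expansion)
  fix i
  have "Suc i * ((b + Suc i) choose Suc i) = Suc (b + i) * ((b + i) choose i)"
    by (simp only: add_Suc_right Suc_times_binomial)
  then have "int (Suc i) * int ((b + Suc i) choose Suc i) = int (Suc (b + i)) * int ((b + i) choose i)"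
    by (metis of_nat_mult)
  then have *: "int (Suc i) * ((- 1) ^ Suc i * int ((b + Suc i) choose Suc i)) =
      - ((- 1) ^ i * (int (Suc (b + i)) * int ((b + i) choose i)))"
    by (subst mult.left_commute) simp
  show "(- 1 - int b) * ((- 1) ^ i * int ((b + i) choose i)) =
     int i * ((- 1) ^ i * int ((b + i) choose i)) + int (Suc i) * ((- 1) ^ Suc i * int ((b + Suc i) choose Suc i))"
    unfolding * by (simp add: algebra_simps)
qed simp

subsection \<open>The reflected binomial coefficients\<close>

text \<open>This is \<open>g M + (- 1) ^ w * g (- M)\<close> for \<open>g x = (x + 1) gchoose (m + 2)\<close>, with the
  negative upper argument \<open>1 - M\<close> rewritten by reflection.\<close>

definition refl_choose :: "nat \<Rightarrow> nat \<Rightarrow> nat \<Rightarrow> int" where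
  "refl_choose w m M =
     int ((M + 1) choose (m + 2)) + (- 1) ^ w * ((- 1) ^ m * int ((M + m) choose (m + 2)))"

text \<open>This is \<open>fact (m + 2) * ((x + 1) gchoose (m + 2))\<close> with its factor
  \<open>x\<close> removed; splitting off \<open>x\<close> makes the divisibility by
  \<open>M\<close> visible.\<close>

definition choose_cofactor :: "nat \<Rightarrow> int \<Rightarrow> int" where
  "choose_cofactor m x = (x + 1) * (\<Prod>i=1..m. x - int i)"

lemma fact_mult_choose_cofactor:
  "fact (m + 2) * int ((M + 1) choose (m + 2)) = int M * choose_cofactor m (int M)"
proof (induction m)
  case 0
  have "2 * ((M + 1) choose 2) = (M + 1) * M"
    using choose_two[of "M + 1"] by (simp add: algebra_simps)
  then have "2 * int ((M + 1) choose 2) = (int M + 1) * int M"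
    by (metis (mono_tags, lifting) of_nat_1 of_nat_add of_nat_mult of_nat_numeral)
  then show ?case by (simp add: choose_cofactor_def numeral_2_eq_2 algebra_simps)
next
  case (Suc m)
  \<comment> \<open>Over the integers this also holds for \<open>k > n\<close>, where both binomial
    coefficients are 0.\<close>
  have *: "int (Suc k) * int (n choose Suc k) = (int n - int k) * int (n choose k)" for n k
  proof (cases "k \<le> n")
    case True
    have "Suc k * (n choose Suc k) = (n - k) * (n choose k)"
      using binomial_absorption binomial_absorb_comp by simp
    then have "int (Suc k) * int (n choose Suc k) = int (n - k) * int (n choose k)"
      by (metis of_nat_mult)
    then show ?thesis using True by (simp add: of_nat_diff)
  qed (simp add: binomial_eq_0)
  have "fact (Suc m + 2) * int ((M + 1) choose (Suc m + 2)) =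
     fact (m + 2) * (int (Suc (m + 2)) * int ((M + 1) choose Suc (m + 2)))"
    by (simp add: algebra_simps)
  also have "\<dots> = (int M - int (Suc m)) * (fact (m + 2) * int ((M + 1) choose (m + 2)))"
    unfolding * by (simp add: algebra_simps)
  also have "\<dots> = (int M - int (Suc m)) * (int M * choose_cofactor m (int M))"
    unfolding Suc.IH ..
  finally show ?case by (simp add: choose_cofactor_def mult_ac)
qed

text \<open>The preceding identity at \<open>x = - M\<close>: by reflection
  \<open>(1 - M) gchoose (m + 2)\<close> equals
  \<open>(- 1) ^ m * ((M + m) choose (m + 2))\<close>.\<close>

lemma fact_mult_choose_cofactor_neg:
  "fact (m + 2) * ((- 1) ^ m * int ((M + m) choose (m + 2))) = - int M * choose_cofactor m (- int M)"
proof (induction m)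
  case 0
  have "2 * (M choose 2) + M = M * M"
    using choose_two[of M] by (cases M) (auto simp: algebra_simps)
  then have "2 * int (M choose 2) + int M = int M * int M"
    by (metis (mono_tags, lifting) of_nat_add of_nat_mult of_nat_numeral)
  then show ?case by (simp add: choose_cofactor_def numeral_2_eq_2 algebra_simps)
next
  case (Suc m)
  have "Suc (m + 2) * (Suc (M + m) choose Suc (m + 2)) = Suc (M + m) * ((M + m) choose (m + 2))"
    by (rule Suc_times_binomial)
  then have *: "int (Suc (m + 2)) * int (Suc (M + m) choose Suc (m + 2)) = int (Suc (M + m)) * int ((M + m) choose (m + 2))"
    by (metis of_nat_mult)
  have "fact (Suc m + 2) * ((- 1) ^ Suc m * int ((M + Suc m) choose (Suc m + 2))) =
     - (fact (m + 2) * (- 1) ^ m * (int (Suc (m + 2)) * int (Suc (M + m) choose Suc (m + 2))))"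
    by (simp add: algebra_simps)
  also have "\<dots> = (- int M - int (Suc m)) * (fact (m + 2) * ((- 1) ^ m * int ((M + m) choose (m + 2))))"
    unfolding * by (simp add: algebra_simps)
  also have "\<dots> = (- int M - int (Suc m)) * (- int M * choose_cofactor m (- int M))"
    unfolding Suc.IH ..
  finally show ?case by (simp add: choose_cofactor_def mult_ac)
qed

lemma fact_mult_refl_choose:
  "fact (m + 2) * refl_choose w m M =
     int M * (choose_cofactor m (int M) - (- 1) ^ w * choose_cofactor m (- int M))"
proof -
  have "fact (m + 2) * refl_choose w m M = fact (m + 2) * int ((M + 1) choose (m + 2)) +
      (- 1) ^ w * (fact (m + 2) * ((- 1) ^ m * int ((M + m) choose (m + 2))))"
    by (simp only: refl_choose_def distrib_left mult.left_commute)
  then show ?thesis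
    unfolding fact_mult_choose_cofactor fact_mult_choose_cofactor_neg by (simp add: algebra_simps)
qed

text \<open>The cofactor is a polynomial in \<open>x\<close> with integer coefficients. At
  \<open>M\<close> and \<open>- M\<close> this supplies the second factor \<open>M\<close> for even
  weight.\<close>

lemma choose_cofactor_diff_dvd: "x - y dvd choose_cofactor m x - choose_cofactor m y"
proof -
  have "[choose_cofactor m x = choose_cofactor m y] (mod x - y)"
    unfolding choose_cofactor_def
    by (intro cong_mult cong_prod cong_add cong_diff) (auto simp: cong_iff_dvd_diff)
  then show ?thesis by (simp add: cong_iff_dvd_diff)
qed

text \<open>Dividing by \<open>fact n\<close> costs at most its \<open>p\<close>-part; the factor
  \<open>p ^ m\<close> pays for it and leaves \<open>e\<close> further powers of
  \<open>p\<close>.\<close>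

lemma prime_power_dvd_of_fact_mult:
  fixes p :: nat and g x :: int
  assumes p: "prime p" and v: "multiplicity p (fact n :: nat) + e \<le> m"
    and g: "fact n * g = int p ^ t * x"
  shows "int p ^ (t + e) dvd int p ^ m * g"
proof -
  define v where "v = multiplicity p (fact n :: nat)"
  obtain f where f: "fact n = p ^ v * f" "\<not> p dvd f"
    using multiplicity_decompose'[of "fact n :: nat" p] p unfolding v_def
    by (metis fact_nonzero not_prime_unit)
  have "int (fact n) = int p ^ v * int f" by (simp add: f(1))
  then have fn: "(fact n :: int) = int p ^ v * int f" by simp
  obtain d where d: "m = v + e + d" using v unfolding v_def by (metis le_Suc_ex)
  have "int f * (int p ^ m * g) = int p ^ (e + d) * (fact n * g)"
    by (simp add: fn d power_add algebra_simps)
  also have "\<dots> = int p ^ (t + e) * (int p ^ d * x)"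
    unfolding g by (simp add: power_add algebra_simps)
  finally have "int p ^ (t + e) dvd int f * (int p ^ m * g)" by simp
  moreover have "coprime (int p ^ (t + e)) (int f)"
    using p f(2) by (simp add: prime_imp_coprime)
  ultimately show ?thesis by (simp add: coprime_dvd_mult_right_iff)
qed

lemma refl_choose_odd_cong:
  assumes p: "prime p" "p \<ge> 5" and w: "odd w"
  shows "[int p ^ m * refl_choose w m (p ^ t) = (if m = 0 then int p ^ t else 0)] (mod int p ^ (t + 1))"
proof (cases "m = 0")
  case True
  have "2 * refl_choose w 0 (p ^ t) = 2 * int (p ^ t)"
    using fact_mult_refl_choose[of 0 w "p ^ t"] w
    by (simp add: choose_cofactor_def numeral_2_eq_2 algebra_simps)
  then show ?thesis using True by simp
next
  case False
  \<comment> \<open>With \<open>p - 1 \<ge> 4\<close> the valuation \<open>v\<close> satisfies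
    \<open>4 * v < m + 2\<close>, which forces \<open>v + 1 \<le> m\<close> as soon as
    \<open>m \<ge> 1\<close>.\<close>
  have "4 * multiplicity p (fact (m + 2) :: nat) \<le> (p - 1) * multiplicity p (fact (m + 2) :: nat)"
    using p by (intro mult_right_mono) auto
  also have "\<dots> < m + 2" using multiplicity_fact_less[OF p(1), of "m + 2"] by simp
  finally have "multiplicity p (fact (m + 2) :: nat) + 1 \<le> m" using False by linarith
  then have "int p ^ (t + 1) dvd int p ^ m * refl_choose w m (p ^ t)"
    using fact_mult_refl_choose[of m w "p ^ t"]
    unfolding of_nat_power by (intro prime_power_dvd_of_fact_mult[OF p(1)])
  then show ?thesis using False by (simp add: cong_0_iff)
qed

lemma refl_choose_even_cong:
  assumes p: "prime p" "p \<ge> 5" and w: "even w"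
  shows "[int p ^ m * refl_choose w m (p ^ t) = (if m = 0 then int p ^ (2 * t) else 0)] (mod int p ^ (2 * t + 2))"
proof -
  consider "m = 0" | "m = 1" | "m \<ge> 2" by linarith
  then show ?thesis
  proof cases
    case 1
    have "2 * refl_choose w 0 (p ^ t) = 2 * (int (p ^ t))\<^sup>2"
      using fact_mult_refl_choose[of 0 w "p ^ t"] w
      by (simp add: choose_cofactor_def numeral_2_eq_2 algebra_simps)
    then show ?thesis using 1 by (simp add: power_mult mult.commute)
  next
    \<comment> \<open>The cofactor for \<open>m = 1\<close> is the even polynomial
      \<open>x ^ 2 - 1\<close>, so the two halves cancel exactly.\<close>
    case 2
    have "6 * refl_choose w 1 (p ^ t) = 0"
      using fact_mult_refl_choose[of 1 w "p ^ t"] w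
      by (simp add: choose_cofactor_def numeral_3_eq_3 algebra_simps)
    then show ?thesis using 2 by simp
  next
    case 3
    define M where "M = int p ^ t"
    have "M dvd M - (- M)" by simp
    also have "\<dots> dvd choose_cofactor m M - choose_cofactor m (- M)"
      by (rule choose_cofactor_diff_dvd)
    finally obtain x where x: "choose_cofactor m M - choose_cofactor m (- M) = M * x" ..
    have "fact (m + 2) * refl_choose w m (p ^ t) = int p ^ (2 * t) * x"
      using fact_mult_refl_choose[of m w "p ^ t"] w x
      by (simp add: M_def mult_2 power_add)
    \<comment> \<open>The bound \<open>4 * v < m + 2\<close> yields \<open>v + 2 \<le> m\<close>
      only from \<open>m = 2\<close> on, which is why \<open>m = 1\<close> is treated
      separately.\<close>
    moreover have "4 * multiplicity p (fact (m + 2) :: nat) \<le> (p - 1) * multiplicity p (fact (m + 2) :: nat)"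
      using p by (intro mult_right_mono) auto
    then have "4 * multiplicity p (fact (m + 2) :: nat) < m + 2"
      using multiplicity_fact_less[OF p(1), of "m + 2"] by linarith
    then have "multiplicity p (fact (m + 2) :: nat) + 2 \<le> m" using 3 by linarith
    ultimately have "int p ^ (2 * t + 2) dvd int p ^ m * refl_choose w m (p ^ t)"
      by (intro prime_power_dvd_of_fact_mult[OF p(1)])
    then show ?thesis using 3 by (simp add: cong_0_iff)
  qed
qed

subsection \<open>Decomposition by residues\<close>

text \<open>Zero entries are excluded by the divisibility conditions, since
  \<open>p dvd 0\<close>.\<close>

definition unit_triples :: "nat \<Rightarrow> nat \<Rightarrow> (nat \<times> nat \<times> nat) set" where
  "unit_triples p n = {(x, y, z) \<in> triples n. \<not> p dvd x \<and> \<not> p dvd y \<and> \<not> p dvd z}"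

lemma finite_unit_triples [simp]: "finite (unit_triples p n)"
  by (rule finite_subset[OF _ finite_triples[of n]]) (auto simp: unit_triples_def)

lemma unit_triples_less:
  assumes "(x, y, z) \<in> unit_triples p p"
  shows "0 < x" "x < p" "0 < y" "y < p" "0 < z" "z < p" "x + y + z = p"
proof -
  have *: "0 < u \<and> u < p" if "\<not> p dvd u" "u \<le> p" for u
    using that by (metis dvd_0_right dvd_refl le_neq_implies_less neq0_conv)
  have "x \<le> p" "y \<le> p" "z \<le> p" using assms by (auto simp: unit_triples_def triples_def)
  then show "0 < x" "x < p" "0 < y" "y < p" "0 < z" "z < p" "x + y + z = p"
    using assms *[of x] *[of y] *[of z] by (auto simp: unit_triples_def triples_def)
qed

text \<open>Division with remainder splits the triples by the sum of their residues. Both classes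
  are indexed by the same triples \<open>(a, b, c)\<close> of sum \<open>p\<close>, so that they can
  later be merged term by term. The quotients add up to \<open>M - 1\<close> or
  \<open>M - 2\<close>; writing this as an addition makes the index sets empty when \<open>M\<close>
  is too small.\<close>

lemma sum_unit_triples_decompose:
  fixes f :: "nat \<Rightarrow> nat \<Rightarrow> nat \<Rightarrow> 'a :: comm_monoid_add"
  assumes p: "p > 1"
  shows "(\<Sum>(x, y, z)\<in>unit_triples p (p * M). f x y z) =
    (\<Sum>(a, b, c)\<in>unit_triples p p.
       (\<Sum>(x, y, z) | x + y + z + 1 = M. f (a + p * x) (b + p * y) (c + p * z)) +
       (\<Sum>(x, y, z) | x + y + z + 2 = M. f (p - a + p * x) (p - b + p * y) (p - c + p * z)))"
proof -
  let ?T = "unit_triples p (p * M)" and ?A = "unit_triples p p"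
  let ?c = "\<lambda>(x, y, z). x mod p + y mod p + z mod p"
  let ?B1 = "{(x, y, z). x + y + z + 1 = M}" and ?B2 = "{(x, y, z). x + y + z + 2 = M}"
  have fin: "finite ?B1" "finite ?B2"
    by (rule finite_subset[of _ "{..M} \<times> {..M} \<times> {..M}"]; auto)+
  \<comment> \<open>The residue sum is a multiple of \<open>p\<close> strictly between 0 and
    \<open>3 * p\<close>.\<close>
  have carry: "?c t = p \<or> ?c t = 2 * p" if "t \<in> ?T" for t
  proof -
    obtain x y z where t: "t = (x, y, z)" by (cases t)
    have "p dvd x + y + z" using that by (auto simp: t unit_triples_def triples_def)
    then have d: "p dvd x mod p + y mod p + z mod p"
      by (metis mod_0_imp_dvd dvd_imp_mod_0 mod_add_eq mod_add_left_eq)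
    then obtain k where k: "x mod p + y mod p + z mod p = p * k" ..
    have "x mod p > 0" using that by (auto simp: t unit_triples_def dvd_eq_mod_eq_0)
    moreover have "x mod p < p" "y mod p < p" "z mod p < p" using p by simp_all
    ultimately have "p * k > p * 0" "p * k < p * 3" unfolding k[symmetric] by linarith+
    then have "k > 0" "k < 3" using p by (metis mult_less_cancel1)+
    then have "k = 1 \<or> k = 2" by linarith
    then show ?thesis using k t by auto
  qed
  have divsum: "p * (x div p + y div p + z div p) + ?c (x, y, z) = p * M" if "(x, y, z) \<in> ?T" for x y z
  proof -
    have "x + y + z = p * M" using that by (auto simp: unit_triples_def triples_def)
    moreover have "p * (x div p + y div p + z div p) + ?c (x, y, z) =
       (p * (x div p) + x mod p) + (p * (y div p) + y mod p) + (p * (z div p) + z mod p)"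
      by (simp add: algebra_simps)
    ultimately show ?thesis by simp
  qed
  have s1: "(\<Sum>(x, y, z)\<in>{t \<in> ?T. ?c t = p}. f x y z) =
     (\<Sum>((a, b, c), (x, y, z))\<in>?A \<times> ?B1. f (a + p * x) (b + p * y) (c + p * z))"
  proof (rule sum.reindex_bij_witness[of _ "\<lambda>((a, b, c), (x, y, z)). (a + p * x, b + p * y, c + p * z)"
        "\<lambda>(x, y, z). ((x mod p, y mod p, z mod p), (x div p, y div p, z div p))"], goal_cases)
    case (2 t)
    obtain x y z where t: "t = (x, y, z)" by (cases t)
    have T: "(x, y, z) \<in> ?T" and c: "?c (x, y, z) = p" using 2 t by auto
    have "p * (x div p + y div p + z div p + 1) = p * M" using divsum[OF T] unfolding c by (simp add: algebra_simps)
    then have "x div p + y div p + z div p + 1 = M" using p by (metis mult_cancel1 not_one_less_zero)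
    then show ?case using T c t by (auto simp: unit_triples_def triples_def dvd_mod_iff)
  next
    case (4 s)
    obtain a b c x y z where s: "s = ((a, b, c), (x, y, z))" by (metis prod.collapse)
    have A: "(a, b, c) \<in> ?A" and B: "x + y + z + 1 = M" using 4 s by auto
    have "p * M = p + (p * x + p * y + p * z)" unfolding B[symmetric] by (simp add: algebra_simps)
    then have "a + p * x + (b + p * y) + (c + p * z) = p * M"
      using unit_triples_less(7)[OF A] by linarith
    moreover have "\<not> p dvd a" "\<not> p dvd b" "\<not> p dvd c" using A by (auto simp: unit_triples_def)
    ultimately show ?case using unit_triples_less[OF A]
      by (simp add: s unit_triples_def triples_def dvd_add_left_iff)
  next
    case (3 s)
    then show ?case by (auto dest: unit_triples_less)
  qed auto
  \<comment> \<open>Here the residues add up to \<open>2 * p\<close>, so their complements to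
    \<open>p\<close> add up to \<open>3 * p - 2 * p = p\<close> and form a triple in
    \<open>?A\<close>.\<close>
  have s2: "(\<Sum>(x, y, z)\<in>{t \<in> ?T. ?c t = 2 * p}. f x y z) =
     (\<Sum>((a, b, c), (x, y, z))\<in>?A \<times> ?B2. f (p - a + p * x) (p - b + p * y) (p - c + p * z))"
  proof (rule sum.reindex_bij_witness[of _ "\<lambda>((a, b, c), (x, y, z)). (p - a + p * x, p - b + p * y, p - c + p * z)"
        "\<lambda>(x, y, z). ((p - x mod p, p - y mod p, p - z mod p), (x div p, y div p, z div p))"], goal_cases)
    case (1 t)
    have "p - (p - x mod p) + p * (x div p) = x" for x
    proof -
      have "x mod p < p" using p by simp
      then have "p - (p - x mod p) = x mod p" by linarith
      then show ?thesis by simp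
    qed
    then show ?case by (cases t) simp
  next
    case (2 t)
    obtain x y z where t: "t = (x, y, z)" by (cases t)
    have T: "(x, y, z) \<in> ?T" and c: "?c (x, y, z) = 2 * p" using 2 t by auto
    have "p * (x div p + y div p + z div p + 2) = p * M" using divsum[OF T] unfolding c by (simp add: algebra_simps)
    then have "x div p + y div p + z div p + 2 = M" using p by (metis mult_cancel1 not_one_less_zero)
    moreover have l: "x mod p < p" "y mod p < p" "z mod p < p" using p by simp_all
    moreover have "\<not> p dvd p - u mod p" if "\<not> p dvd u" for u
    proof -
      have "0 < u mod p" using that by (simp add: dvd_eq_mod_eq_0)
      then show ?thesis using p by (intro nat_dvd_not_less) auto
    qed
    moreover have "p - x mod p + (p - y mod p) + (p - z mod p) = p" using l c by simp
    ultimately show ?case using T t by (auto simp: unit_triples_def triples_def)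
  next
    case (4 s)
    obtain a b c x y z where s: "s = ((a, b, c), (x, y, z))" by (metis prod.collapse)
    have A: "(a, b, c) \<in> ?A" and B: "x + y + z + 2 = M" using 4 s by auto
    have "p * M = 2 * p + (p * x + p * y + p * z)" unfolding B[symmetric] by (simp add: algebra_simps)
    moreover define a' b' c' where d: "a' = p - a" "b' = p - b" "c' = p - c"
    moreover have l: "0 < a'" "a' < p" "0 < b'" "b' < p" "0 < c'" "c' < p" "a' + b' + c' = 2 * p"
      using unit_triples_less[OF A] d by linarith+
    ultimately have "a' + p * x + (b' + p * y) + (c' + p * z) = p * M"
      by linarith
    then show ?case using l
      by (simp add: s unit_triples_def triples_def dvd_add_left_iff nat_dvd_not_less flip: d)
  next
    case (3 s)
    obtain a b c x y z where s: "s = ((a, b, c), (x, y, z))" by (metis prod.collapse)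
    have A: "(a, b, c) \<in> ?A" using 3 s by auto
    have "p - (p - u + p * v) mod p = u \<and> (p - u + p * v) div p = v" if "0 < u" "u < p" for u v
    proof -
      define u' where "u' = p - u"
      have "u' < p" "u = p - u'" using that by (auto simp: u'_def)
      then show ?thesis by (simp flip: u'_def)
    qed
    then show ?case using unit_triples_less[OF A] by (simp only: s split_conv)
  next
    case (5 t)
    have "p - (p - x mod p) + p * (x div p) = x" for x
    proof -
      have "x mod p < p" using p by simp
      then have "p - (p - x mod p) = x mod p" by linarith
      then show ?thesis by simp
    qed
    then show ?case by (cases t) simp
  qed
  have "?T = {t \<in> ?T. ?c t = p} \<union> {t \<in> ?T. ?c t = 2 * p}" using carry by blast
  then have "(\<Sum>(x, y, z)\<in>?T. f x y z) = (\<Sum>(x, y, z)\<in>{t \<in> ?T. ?c t = p} \<union> {t \<in> ?T. ?c t = 2 * p}. f x y z)"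
    by simp
  also have "\<dots> = (\<Sum>(x, y, z)\<in>{t \<in> ?T. ?c t = p}. f x y z) + (\<Sum>(x, y, z)\<in>{t \<in> ?T. ?c t = 2 * p}. f x y z)"
    using p by (intro sum.union_disjoint) auto
  also have "\<dots> = (\<Sum>(a, b, c)\<in>?A. \<Sum>(x, y, z)\<in>?B1. f (a + p * x) (b + p * y) (c + p * z)) +
     (\<Sum>(a, b, c)\<in>?A. \<Sum>(x, y, z)\<in>?B2. f (p - a + p * x) (p - b + p * y) (p - c + p * z))"
    unfolding s1 s2 by (simp add: sum.cartesian_product case_prod_unfold)
  finally show ?thesis
    by (simp add: sum.distrib case_prod_unfold)
qed

text \<open>Multiplying out three expansions in one family \<open>\<phi>\<close> leaves only sums of
  products of \<open>\<phi>\<close> over \<open>S\<close>, which the convolution identities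
  evaluate.\<close>

lemma sum_triples_expand:
  fixes \<phi> :: "nat \<Rightarrow> nat \<Rightarrow> int" and c d e :: "nat \<Rightarrow> int"
  assumes "\<And>x. f x = (\<Sum>i\<le>A. c i * \<phi> i x)" and "\<And>x. g x = (\<Sum>i\<le>B. d i * \<phi> i x)"
    and "\<And>x. h x = (\<Sum>i\<le>C. e i * \<phi> i x)"
  shows "(\<Sum>(x, y, z)\<in>S. f x * g y * h z) =
    (\<Sum>(i, j, k)\<in>{..A} \<times> {..B} \<times> {..C}. c i * d j * e k * (\<Sum>(x, y, z)\<in>S. \<phi> i x * \<phi> j y * \<phi> k z))"
proof -
  have prod3: "sum a I * sum b J * sum c K = (\<Sum>i\<in>I. \<Sum>j\<in>J. \<Sum>k\<in>K. a i * b j * c k)"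
    for a b c :: "nat \<Rightarrow> int" and I J K
    by (subst sum_product) (simp only: sum_distrib_right, simp only: sum_distrib_left)
  have "f x * g y * h z =
     (\<Sum>(i, j, k)\<in>{..A} \<times> {..B} \<times> {..C}. c i * d j * e k * (\<phi> i x * \<phi> j y * \<phi> k z))" for x y z
    unfolding assms prod3 by (simp add: sum.cartesian_product[symmetric] mult_ac)
  then show ?thesis
    by (simp add: case_prod_unfold sum_distrib_left) (rule sum.swap)
qed

definition power_sum :: "nat \<Rightarrow> nat \<Rightarrow> nat \<Rightarrow> nat \<Rightarrow> nat \<Rightarrow> int" where
  "power_sum p n A B C = (\<Sum>(x, y, z)\<in>unit_triples p n. int x ^ A * int y ^ B * int z ^ C)"

subsection \<open>Congruences for the power sums\<close>

lemma sum_triples_shift_eq: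
  assumes "M > 0"
  shows "(\<Sum>(x, y, z) | x + y + z + 1 = M. int (x choose i) * int (y choose j) * int (z choose k)) =
    int ((M + 1) choose (i + j + k + 2))"
proof -
  have "{(x, y, z). x + y + z + 1 = M} = triples (M - 1)"
    using assms by (auto simp: triples_def)
  then have "(\<Sum>(x, y, z) | x + y + z + 1 = M. int (x choose i) * int (y choose j) * int (z choose k)) =
    int (\<Sum>(x, y, z)\<in>triples (M - 1). (x choose i) * (y choose j) * (z choose k))"
    by (simp add: of_nat_sum case_prod_unfold)
  then show ?thesis using assms unfolding sum_triples_choose by simp
qed

lemma sum_triples_shift_neg_eq:
  assumes "M > 0"
  shows "(\<Sum>(x, y, z) | x + y + z + 2 = M.
      (- 1) ^ i * int ((x + i) choose i) * ((- 1) ^ j * int ((y + j) choose j)) * ((- 1) ^ k * int ((z + k) choose k))) =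
    (- 1) ^ (i + j + k) * int ((M + (i + j + k)) choose (i + j + k + 2))"
\<comment> \<open>For \<open>M = 1\<close> the truncated \<open>M - 2\<close> would be wrong; the
  index set is empty and the binomial coefficient on the right is 0 as well.\<close>
proof (cases "M = 1")
  case True
  then have "{(x, y, z). x + y + z + 2 = M} = {}" by auto
  then show ?thesis using True by (simp add: binomial_eq_0)
next
  case False
  then have "{(x, y, z). x + y + z + 2 = M} = triples (M - 2)"
    using assms by (auto simp: triples_def)
  then have "(\<Sum>(x, y, z) | x + y + z + 2 = M.
      (- 1) ^ i * int ((x + i) choose i) * ((- 1) ^ j * int ((y + j) choose j)) * ((- 1) ^ k * int ((z + k) choose k))) =
    (- 1) ^ (i + j + k) * int (\<Sum>(x, y, z)\<in>triples (M - 2). ((x + i) choose i) * ((y + j) choose j) * ((z + k) choose k))"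
    by (simp add: of_nat_sum case_prod_unfold sum_distrib_left power_add mult_ac)
  moreover have "M - 2 + (i + j + k + 2) = M + (i + j + k)" using False assms by simp
  ultimately show ?thesis by (simp only: sum_triples_choose_add)
qed

text \<open>The Newton coefficients depend on the residues alone, so \<open>M\<close> enters only
  through \<open>refl_choose\<close>.\<close>

lemma power_sum_eq:
  assumes p: "p > 1" and M: "M > 0"
  shows "power_sum p (p * M) A B C =
    (\<Sum>(a, b, c)\<in>unit_triples p p. \<Sum>(i, j, k)\<in>{..A} \<times> {..B} \<times> {..C}.
       newton_coeff p a A i * newton_coeff p b B j * newton_coeff p c C k *
       (int p ^ (i + j + k) * refl_choose (A + B + C) (i + j + k) M))"
proof -
  let ?I = "{..A} \<times> {..B} \<times> {..C}"
  let ?w = "(- 1 :: int) ^ (A + B + C)"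
  have "(\<Sum>(x, y, z) | x + y + z + 1 = M. int (a + p * x) ^ A * int (b + p * y) ^ B * int (c + p * z) ^ C) +
        (\<Sum>(x, y, z) | x + y + z + 2 = M. int (p - a + p * x) ^ A * int (p - b + p * y) ^ B * int (p - c + p * z) ^ C) =
       (\<Sum>(i, j, k)\<in>?I. newton_coeff p a A i * newton_coeff p b B j * newton_coeff p c C k *
       (int p ^ (i + j + k) * refl_choose (A + B + C) (i + j + k) M))"
    (is "?S1 + ?S2 = ?R")
    if abc: "(a, b, c) \<in> unit_triples p p" for a b c
  proof -
    let ?u = "\<lambda>i. int p ^ i * newton_coeff p a A i" and ?v = "\<lambda>i. int p ^ i * newton_coeff p b B i"
      and ?t = "\<lambda>i. int p ^ i * newton_coeff p c C i"
    have "?S1 = (\<Sum>(x, y, z) | x + y + z + 1 = M.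
       (int a + int p * int x) ^ A * (int b + int p * int y) ^ B * (int c + int p * int z) ^ C)"
      by simp
    also have "\<dots> = (\<Sum>(i, j, k)\<in>?I. ?u i * ?v j * ?t k * int ((M + 1) choose (i + j + k + 2)))"
      by (subst sum_triples_expand[OF newton_expansion_choose newton_expansion_choose newton_expansion_choose])
         (simp only: sum_triples_shift_eq[OF M])
    finally have S1: "?S1 = \<dots>" .
    \<comment> \<open>An entry with complementary residue is \<open>- (a + p * (- 1 - x))\<close>:
      the second class uses the same Newton coefficients, at the cost of the global sign
      \<open>?w\<close>.\<close>
    have neg: "int (p - d + p * x) ^ n = (- 1) ^ n * (int d + int p * (- 1 - int x)) ^ n" if "d < p" for d x n
    proof -
      have "int (p - d + p * x) = - 1 * (int d + int p * (- 1 - int x))"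
        using that by (simp add: of_nat_diff algebra_simps)
      then show ?thesis by (simp only: power_mult_distrib)
    qed
    have "?S2 = ?w * (\<Sum>(x, y, z) | x + y + z + 2 = M.
       (int a + int p * (- 1 - int x)) ^ A * (int b + int p * (- 1 - int y)) ^ B * (int c + int p * (- 1 - int z)) ^ C)"
      unfolding neg[OF unit_triples_less(2)[OF abc]] neg[OF unit_triples_less(4)[OF abc]] neg[OF unit_triples_less(6)[OF abc]]
      by (simp only: sum_distrib_left case_prod_unfold power_add mult_ac)
    also have "\<dots> = ?w * (\<Sum>(i, j, k)\<in>?I. ?u i * ?v j * ?t k * ((- 1) ^ (i + j + k) * int ((M + (i + j + k)) choose (i + j + k + 2))))"
      by (subst sum_triples_expand[OF newton_expansion_choose_neg newton_expansion_choose_neg newton_expansion_choose_neg])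
         (simp only: sum_triples_shift_neg_eq[OF M])
    finally have S2: "?S2 = \<dots>" .
    show ?thesis unfolding S1 S2 sum_distrib_left sum.distrib[symmetric]
      by (intro sum.cong) (auto simp: refl_choose_def power_add algebra_simps)
  qed
  then show ?thesis
    unfolding power_sum_def sum_unit_triples_decompose[OF p]
    by (intro sum.cong) auto
qed

text \<open>By \<open>G\<close> only the index \<open>(0, 0, 0)\<close> survives modulo
  \<open>N\<close>. The Newton coefficients there are \<open>a ^ A\<close>, \<open>b ^ B\<close> and
  \<open>c ^ C\<close>, which gives the power sum for \<open>p\<close> itself.\<close>

lemma power_sum_cong:
  assumes p: "p > 1" and M: "M > 0"
    and G: "\<And>m. [int p ^ m * refl_choose (A + B + C) m M = (if m = 0 then D else 0)] (mod N)"
  shows "[power_sum p (p * M) A B C = D * power_sum p p A B C] (mod N)"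
proof -
  let ?I = "{..A} \<times> {..B} \<times> {..C}"
  have "[power_sum p (p * M) A B C = (\<Sum>(a, b, c)\<in>unit_triples p p. \<Sum>(i, j, k)\<in>?I.
       newton_coeff p a A i * newton_coeff p b B j * newton_coeff p c C k * (if i + j + k = 0 then D else 0))] (mod N)"
    unfolding power_sum_eq[OF p M] case_prod_unfold
    by (intro cong_sum cong_mult cong_refl G)
  also have "(\<Sum>(a, b, c)\<in>unit_triples p p. \<Sum>(i, j, k)\<in>?I.
       newton_coeff p a A i * newton_coeff p b B j * newton_coeff p c C k * (if i + j + k = 0 then D else 0)) =
     (\<Sum>(a, b, c)\<in>unit_triples p p. D * (int a ^ A * int b ^ B * int c ^ C))"
  proof (intro sum.cong refl, clarify)
    fix a b c :: nat
    have "(\<Sum>(i, j, k)\<in>?I. newton_coeff p a A i * newton_coeff p b B j * newton_coeff p c C k * (if i + j + k = 0 then D else 0)) =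
      (\<Sum>(i, j, k)\<in>{(0, 0, 0)}. newton_coeff p a A i * newton_coeff p b B j * newton_coeff p c C k * (if i + j + k = 0 then D else 0))"
      by (rule sum.mono_neutral_right) (auto split: if_splits)
    then show "(\<Sum>(i, j, k)\<in>?I. newton_coeff p a A i * newton_coeff p b B j * newton_coeff p c C k * (if i + j + k = 0 then D else 0)) =
       D * (int a ^ A * int b ^ B * int c ^ C)" by simp
  qed
  also have "\<dots> = D * power_sum p p A B C"
    by (simp add: power_sum_def sum_distrib_left case_prod_unfold)
  finally show ?thesis .
qed

lemma power_sum_odd_cong:
  assumes "prime p" "p \<ge> 5" "odd (A + B + C)"
  shows "[power_sum p (p ^ Suc t) A B C = int p ^ t * power_sum p p A B C] (mod int p ^ Suc t)"
  using power_sum_cong[of p "p ^ t"] refl_choose_odd_cong[OF assms] assms(2) by simp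

lemma power_sum_even_cong:
  assumes "prime p" "p \<ge> 5" "even (A + B + C)"
  shows "[power_sum p (p ^ Suc t) A B C = int p ^ (2 * t) * power_sum p p A B C] (mod int p ^ (2 * Suc t))"
  using power_sum_cong[of p "p ^ t"] refl_choose_even_cong[OF assms] assms(2) by simp

subsection \<open>Reduction to power sums\<close>

text \<open>Frees the notion from lowest terms, so that the closure properties can use any
  convenient fraction.\<close>

lemma p_integral_iff:
  "x \<in> p_integral p \<longleftrightarrow> (\<exists>a b. \<not> int p dvd b \<and> x = of_int a / of_int b)"
proof
  assume "x \<in> p_integral p"
  then show "\<exists>a b. \<not> int p dvd b \<and> x = of_int a / of_int b"
    using quotient_of_div[of x "fst (quotient_of x)" "snd (quotient_of x)"]
    by (auto simp: p_integral_def)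
next
  assume "\<exists>a b. \<not> int p dvd b \<and> x = of_int a / of_int b"
  then obtain a b where b: "\<not> int p dvd b" and x: "x = of_int a / of_int b" by blast
  obtain n d where q: "quotient_of x = (n, d)" by (cases "quotient_of x")
  have "d > 0" "coprime n d" "x = of_int n / of_int d"
    using q quotient_of_denom_pos quotient_of_coprime quotient_of_div by blast+
  moreover have "b \<noteq> 0" using b by auto
  ultimately have "(of_int (n * b) :: rat) = of_int (a * d)" using x by (simp add: field_simps)
  \<comment> \<open>The reduced denominator is coprime to \<open>n\<close>, hence divides the
    denominator \<open>b\<close> of any other representation.\<close>
  then have "d dvd n * b" by (simp only: of_int_eq_iff) simp
  then have "d dvd b" using \<open>coprime n d\<close> by (simp add: coprime_dvd_mult_right_iff coprime_commute)
  then show "x \<in> p_integral p" using b q by (auto simp: p_integral_def dest: dvd_trans)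
qed

lemma p_integral_of_int [simp]: "prime p \<Longrightarrow> of_int n \<in> p_integral p"
  unfolding p_integral_iff by (rule exI[of _ n], rule exI[of _ 1]) (auto dest: prime_gt_1_nat)

lemma p_integral_of_nat [simp]: "prime p \<Longrightarrow> of_nat n \<in> p_integral p"
  using p_integral_of_int[of p "int n"] by simp

lemma p_integral_add:
  assumes "prime p" "x \<in> p_integral p" "y \<in> p_integral p"
  shows "x + y \<in> p_integral p"
proof -
  obtain a b c d where *: "\<not> int p dvd b" "\<not> int p dvd d" "x = of_int a / of_int b" "y = of_int c / of_int d"
    using assms(2,3) unfolding p_integral_iff by blast
  then have "b \<noteq> 0" "d \<noteq> 0" by auto
  then have "x + y = of_int (a * d + c * b) / of_int (b * d)" using * by (simp add: field_simps)
  moreover have "\<not> int p dvd b * d" using * assms(1) by (simp add: prime_dvd_mult_iff)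
  ultimately show ?thesis unfolding p_integral_iff by blast
qed

lemma p_integral_mult:
  assumes "prime p" "x \<in> p_integral p" "y \<in> p_integral p"
  shows "x * y \<in> p_integral p"
proof -
  obtain a b c d where *: "\<not> int p dvd b" "\<not> int p dvd d" "x = of_int a / of_int b" "y = of_int c / of_int d"
    using assms(2,3) unfolding p_integral_iff by blast
  then have "x * y = of_int (a * c) / of_int (b * d)" by simp
  moreover have "\<not> int p dvd b * d" using * assms(1) by (simp add: prime_dvd_mult_iff)
  ultimately show ?thesis unfolding p_integral_iff by blast
qed

lemma p_integral_sum:
  assumes "prime p" "\<And>i. i \<in> I \<Longrightarrow> f i \<in> p_integral p"
  shows "sum f I \<in> p_integral p"
  using assms(2)
  by (induction I rule: infinite_finite_induct)
     (use assms(1) p_integral_of_int[of p 0] in \<open>auto intro: p_integral_add\<close>)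

lemma p_integral_cong_trans:
  assumes "prime p" "p_integral_cong p n x y" "p_integral_cong p n y z"
  shows "p_integral_cong p n x z"
proof -
  obtain c d where "c \<in> p_integral p" "d \<in> p_integral p" "x - y = of_nat (p ^ n) * c" "y - z = of_nat (p ^ n) * d"
    using assms(2,3) unfolding p_integral_cong_def by blast
  then have "c + d \<in> p_integral p" "x - z = of_nat (p ^ n) * (c + d)"
    using p_integral_add[OF assms(1)] by (auto simp: algebra_simps)
  then show ?thesis using assms(2,3) unfolding p_integral_cong_def by blast
qed

lemma p_integral_cong_sym:
  assumes "prime p" "p_integral_cong p n x y"
  shows "p_integral_cong p n y x"
proof -
  obtain c where "c \<in> p_integral p" "x - y = of_nat (p ^ n) * c"
    using assms(2) unfolding p_integral_cong_def by blast
  then have "of_int (- 1) * c \<in> p_integral p" "y - x = of_nat (p ^ n) * (of_int (- 1) * c)"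
    using p_integral_mult[OF assms(1) p_integral_of_int[OF assms(1)]]
    by (blast, simp add: algebra_simps)
  then show ?thesis using assms(2) unfolding p_integral_cong_def by blast
qed

lemma p_integral_cong_mult_left:
  assumes "prime p" "x \<in> p_integral p" "p_integral_cong p n y z"
  shows "p_integral_cong p n (x * y) (x * z)"
proof -
  obtain c where "c \<in> p_integral p" "y - z = of_nat (p ^ n) * c"
    using assms(3) unfolding p_integral_cong_def by blast
  then have "x * c \<in> p_integral p" "x * y - x * z = of_nat (p ^ n) * (x * c)"
    using p_integral_mult[OF assms(1,2)] by (auto simp flip: right_diff_distrib)
  then show ?thesis using assms p_integral_mult unfolding p_integral_cong_def by blast
qed

lemma p_integral_cong_of_int:
  assumes "prime p" "[a = b] (mod int p ^ n)"
  shows "p_integral_cong p n (of_int a) (of_int b)"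
proof -
  obtain c where "a - b = int p ^ n * c"
    using assms(2) by (auto simp: cong_iff_dvd_diff)
  then have "(of_int a - of_int b :: rat) = of_nat (p ^ n) * of_int c"
    by (metis of_int_diff of_int_mult of_int_of_nat_eq of_nat_power)
  then show ?thesis using assms(1) unfolding p_integral_cong_def by auto
qed

lemma p_integral_cong_mono:
  assumes "prime p" "p_integral_cong p n x y" "m \<le> n"
  shows "p_integral_cong p m x y"
proof -
  obtain c where "c \<in> p_integral p" "x - y = of_nat (p ^ n) * c"
    using assms(2) unfolding p_integral_cong_def by blast
  then have "of_nat (p ^ (n - m)) * c \<in> p_integral p" "x - y = of_nat (p ^ m) * (of_nat (p ^ (n - m)) * c)"
    using p_integral_mult[OF assms(1) p_integral_of_nat[OF assms(1)]] assms(3)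
    by (blast, simp flip: mult.assoc power_add)
  then show ?thesis using assms(2) unfolding p_integral_cong_def by blast
qed

lemma p_integral_cong_sum:
  assumes "prime p" "\<And>i. i \<in> I \<Longrightarrow> p_integral_cong p n (f i) (g i)"
  shows "p_integral_cong p n (sum f I) (sum g I)"
proof -
  have "\<forall>i\<in>I. \<exists>c. c \<in> p_integral p \<and> f i - g i = of_nat (p ^ n) * c"
    using assms(2) unfolding p_integral_cong_def by blast
  then obtain c where c: "\<And>i. i \<in> I \<Longrightarrow> c i \<in> p_integral p"
      "\<And>i. i \<in> I \<Longrightarrow> f i - g i = of_nat (p ^ n) * c i"
    by metis
  have "sum f I - sum g I = of_nat (p ^ n) * sum c I"
    using c(2) by (simp add: sum_distrib_left flip: sum_subtractf)
  then show ?thesis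
    using assms c(1) p_integral_sum[OF assms(1)] unfolding p_integral_cong_def by blast
qed

section \<open>Replacing reciprocals by positive powers\<close>

lemma Zsum_eq_sum_unit_triples:
  "Zsum p r [\<alpha>, \<beta>, \<gamma>] =
    (\<Sum>(x, y, z)\<in>unit_triples p (p ^ r). 1 / (of_nat x ^ \<alpha> * of_nat y ^ \<beta> * of_nat z ^ \<gamma>))"
  unfolding Zsum_def
proof (rule sum.reindex_bij_witness[of _ "\<lambda>(x, y, z). [x, y, z]" "\<lambda>k. (k ! 0, k ! 1, k ! 2)"], goal_cases)
  case (1 k)
  then show ?case by (auto simp: length_Suc_conv)
next
  case (2 k)
  then show ?case by (auto simp: length_Suc_conv unit_triples_def triples_def pos_nondiv_def)
next
  case (4 k)
  then show ?case by (auto simp: unit_triples_def triples_def pos_nondiv_def intro!: Nat.gr0I)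
next
  case (5 k)
  then show ?case by (auto simp: length_Suc_conv lessThan_Suc eval_nat_numeral mult_ac)
qed auto

text \<open>By Euler's theorem the integer on the right is an inverse of the denominator modulo
  \<open>p ^ n\<close>. The bounds by \<open>\<phi>\<close> keep the exponent subtractions
  exact.\<close>

lemma p_integral_cong_inverse_power:
  assumes p: "prime p" and xyz: "\<not> p dvd x" "\<not> p dvd y" "\<not> p dvd z"
    and \<phi>: "\<phi> = totient (p ^ n)" "\<alpha> \<le> \<phi>" "\<beta> \<le> \<phi>" "\<gamma> \<le> \<phi>"
  shows "p_integral_cong p n (1 / (of_nat x ^ \<alpha> * of_nat y ^ \<beta> * of_nat z ^ \<gamma>))
    (of_int (int x ^ (\<phi> - \<alpha>) * int y ^ (\<phi> - \<beta>) * int z ^ (\<phi> - \<gamma>)))"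
proof -
  define e where "e = int x ^ \<alpha> * int y ^ \<beta> * int z ^ \<gamma>"
  define f where "f = int x ^ (\<phi> - \<alpha>) * int y ^ (\<phi> - \<beta>) * int z ^ (\<phi> - \<gamma>)"
  have "\<not> p dvd x ^ \<alpha> * y ^ \<beta> * z ^ \<gamma>"
    using p xyz by (auto simp: prime_dvd_mult_iff dest: prime_dvd_power)
  moreover have "e = int (x ^ \<alpha> * y ^ \<beta> * z ^ \<gamma>)" by (simp add: e_def)
  ultimately have pe: "\<not> int p dvd e" by (simp only: of_nat_dvd_iff not_False_eq_True)
  then have e0: "e \<noteq> 0" by auto
  have euler: "[int u ^ \<phi> = 1] (mod int p ^ n)" if "\<not> p dvd u" for u
  proof -
    have "coprime u (p ^ n)" using that p by (simp add: prime_imp_coprime coprime_commute)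
    then have "[u ^ \<phi> = 1] (mod p ^ n)" unfolding \<phi>(1) by (rule euler_theorem)
    then have "[int (u ^ \<phi>) = int 1] (mod int (p ^ n))" by (simp only: cong_int_iff)
    then show ?thesis by simp
  qed
  have pw: "int u ^ k * int u ^ (\<phi> - k) = int u ^ \<phi>" if "k \<le> \<phi>" for u k
    using that by (simp flip: power_add)
  have "e * f = (int x ^ \<alpha> * int x ^ (\<phi> - \<alpha>)) * (int y ^ \<beta> * int y ^ (\<phi> - \<beta>)) * (int z ^ \<gamma> * int z ^ (\<phi> - \<gamma>))"
    by (simp only: e_def f_def mult_ac)
  also have "\<dots> = int x ^ \<phi> * int y ^ \<phi> * int z ^ \<phi>" using pw \<phi> by simp
  finally have "[e * f = 1 * 1 * 1] (mod int p ^ n)"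
    by (simp only:) (intro cong_mult euler xyz)
  then obtain c where c: "e * f - 1 = int p ^ n * c" by (auto simp: cong_iff_dvd_diff)
  \<comment> \<open>Dividing \<open>e * f - 1 = p ^ n * c\<close> by \<open>e\<close>, which is
    prime to \<open>p\<close>, keeps the factor \<open>p ^ n\<close>.\<close>
  then have "(of_int (e * f - 1) :: rat) = of_int (int p ^ n * c)" by (simp only:)
  then have "1 / of_int e - of_int f = (of_nat (p ^ n) :: rat) * (of_int (- c) / of_int e)"
    using e0 by (simp add: field_simps)
  moreover have "1 / of_int e \<in> p_integral p" "of_int (- c) / of_int e \<in> p_integral p"
    unfolding p_integral_iff using pe by (metis of_int_1, blast)
  ultimately have "p_integral_cong p n (1 / of_int e) (of_int f)"
    using p_integral_of_int[OF p] unfolding p_integral_cong_def by blast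
  then show ?thesis by (simp add: e_def f_def)
qed

lemma Zsum_cong_power_sum:
  assumes p: "prime p"
    and \<phi>: "\<phi> = totient (p ^ n)" "\<alpha> \<le> \<phi>" "\<beta> \<le> \<phi>" "\<gamma> \<le> \<phi>"
  shows "p_integral_cong p n (Zsum p s [\<alpha>, \<beta>, \<gamma>])
     (of_int (power_sum p (p ^ s) (\<phi> - \<alpha>) (\<phi> - \<beta>) (\<phi> - \<gamma>)))"
proof -
  have "p_integral_cong p n
     (\<Sum>t\<in>unit_triples p (p ^ s). case t of (x, y, z) \<Rightarrow> 1 / (of_nat x ^ \<alpha> * of_nat y ^ \<beta> * of_nat z ^ \<gamma>))
     (\<Sum>t\<in>unit_triples p (p ^ s). of_int (case t of (x, y, z) \<Rightarrow> int x ^ (\<phi> - \<alpha>) * int y ^ (\<phi> - \<beta>) * int z ^ (\<phi> - \<gamma>)))"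
    by (intro p_integral_cong_sum[OF p])
       (auto simp only: unit_triples_def split_conv mem_Collect_eq intro!: p_integral_cong_inverse_power[OF p _ _ _ \<phi>])
  then show ?thesis
    by (simp only: Zsum_eq_sum_unit_triples power_sum_def of_int_sum)
qed

theorem theorem3p2:
  fixes p r \<alpha> \<beta> \<gamma> :: nat
  assumes "0 < r" and "0 < \<alpha>" and "0 < \<beta>" and "0 < \<gamma>"
    and "prime p" and "p > \<alpha> + \<beta> + \<gamma>"
  shows "(odd (\<alpha> + \<beta> + \<gamma>) \<longrightarrow>
            p_integral_cong p r (Zsum p r [\<alpha>, \<beta>, \<gamma>])
              (of_nat (p ^ (r - 1)) * Zsum p 1 [\<alpha>, \<beta>, \<gamma>])) \<and>
         (even (\<alpha> + \<beta> + \<gamma>) \<longrightarrow>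
            p_integral_cong p (2 * r) (Zsum p r [\<alpha>, \<beta>, \<gamma>])
              (of_nat (p ^ (2 * r - 2)) * Zsum p 1 [\<alpha>, \<beta>, \<gamma>]))"
proof -
  note p = \<open>prime p\<close>
  note [trans] = p_integral_cong_trans[OF p]
  \<comment> \<open>Three positive exponents give \<open>p > 3\<close>, and 4 is not prime.\<close>
  have "p \<noteq> 4" using p by auto
  then have p5: "p \<ge> 5" using assms by linarith
  obtain t where r: "r = Suc t" using \<open>0 < r\<close> by (cases r) auto
  \<comment> \<open>The larger modulus \<open>p ^ (2 * r)\<close> serves both parities; for odd
    weight the congruences are weakened afterwards.\<close>
  define \<phi> where "\<phi> = totient (p ^ (2 * r))"
  have "\<phi> = p ^ (2 * t + 1) * (p - 1)"
    using totient_prime_power_Suc[OF p, of "2 * t + 1"] by (simp add: \<phi>_def r)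
  moreover have "p ^ (2 * t + 1) \<ge> 1" using p5 by simp
  ultimately have "\<phi> \<ge> p - 1" by simp
  then have le: "\<alpha> \<le> \<phi>" "\<beta> \<le> \<phi>" "\<gamma> \<le> \<phi>" using assms by linarith+
  have "p ^ (2 * r) > 2"
  proof -
    have "p ^ 1 \<le> p ^ (2 * r)" using p5 r by (intro power_increasing) auto
    then show ?thesis using p5 by simp
  qed
  \<comment> \<open>Since \<open>\<phi>\<close> is even, replacing \<open>- \<alpha>\<close> by
    \<open>\<phi> - \<alpha>\<close> preserves the parity of the weight.\<close>
  then have ev: "even \<phi>" unfolding \<phi>_def by (rule totient_even)
  define A B C where "A = \<phi> - \<alpha>" and "B = \<phi> - \<beta>" and "C = \<phi> - \<gamma>"
  have par: "even (A + B + C) \<longleftrightarrow> even (\<alpha> + \<beta> + \<gamma>)"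
    using ev le by (auto simp: A_def B_def C_def even_diff_nat)
  \<comment> \<open>Used for \<open>s = r\<close> and \<open>s = 1\<close> with the same exponents
    \<open>A\<close>, \<open>B\<close>, \<open>C\<close>, so that the two power sums can be
    compared.\<close>
  have Z: "p_integral_cong p (2 * r) (Zsum p s [\<alpha>, \<beta>, \<gamma>]) (of_int (power_sum p (p ^ s) A B C))" for s
    unfolding A_def B_def C_def by (rule Zsum_cong_power_sum[OF p \<phi>_def le])
  \<comment> \<open>The chain passes from the rational sum for \<open>p ^ r\<close> to its power
    sum, down to the power sum for \<open>p\<close>, and back to the rational sum for
    \<open>p\<close>.\<close>
  have main: "p_integral_cong p n (Zsum p r [\<alpha>, \<beta>, \<gamma>]) (of_nat (p ^ m) * Zsum p 1 [\<alpha>, \<beta>, \<gamma>])"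
    if n: "n \<le> 2 * r"
      and c: "[power_sum p (p ^ r) A B C = int p ^ m * power_sum p p A B C] (mod int p ^ n)" for n m
  proof -
    have "p_integral_cong p n (Zsum p r [\<alpha>, \<beta>, \<gamma>]) (of_int (power_sum p (p ^ r) A B C))"
      by (rule p_integral_cong_mono[OF p Z n])
    also have "p_integral_cong p n \<dots> (of_int (int p ^ m * power_sum p p A B C))"
      by (rule p_integral_cong_of_int[OF p c])
    also have "of_int (int p ^ m * power_sum p p A B C) =
        (of_nat (p ^ m) * of_int (power_sum p (p ^ 1) A B C) :: rat)" by simp
    also have "p_integral_cong p n \<dots> (of_nat (p ^ m) * Zsum p 1 [\<alpha>, \<beta>, \<gamma>])"
      by (rule p_integral_cong_mult_left[OF p p_integral_of_nat[OF p]
            p_integral_cong_sym[OF p p_integral_cong_mono[OF p Z n]]])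
    finally show ?thesis .
  qed
  show ?thesis
  proof (intro conjI impI)
    assume "odd (\<alpha> + \<beta> + \<gamma>)"
    then show "p_integral_cong p r (Zsum p r [\<alpha>, \<beta>, \<gamma>]) (of_nat (p ^ (r - 1)) * Zsum p 1 [\<alpha>, \<beta>, \<gamma>])"
      using power_sum_odd_cong[OF p p5, of A B C t] par by (intro main) (simp_all add: r)
  next
    assume "even (\<alpha> + \<beta> + \<gamma>)"
    then show "p_integral_cong p (2 * r) (Zsum p r [\<alpha>, \<beta>, \<gamma>]) (of_nat (p ^ (2 * r - 2)) * Zsum p 1 [\<alpha>, \<beta>, \<gamma>])"
      using power_sum_even_cong[OF p p5, of A B C t] par by (intro main) (simp_all add: r)
  qed
qed

end
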